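(* Let $G$ be a finite simple graph embedded in a closed surface, let $\mathcal F\neq\mathcal F(G)$ be a set of even faces, and let $H$ be a connected component of $R(G;\mathcal F)$. Let $\{f_1,\dots,f_k\}$ be the set of all faces corresponding to edges of $H$. For each $i$, the quotient graph $\mathcal H_i$ is bipartite; fix a bipartition $(A_i,B_i)$ of it, and define $\ell_i:V(H)\to\{0,1\}$ by $\ell_i(M)=0$ if the component of $H\setminus E_i$ containing $M$ corresponds to a vertex in $A_i$, and $\ell_i(M)=1$ if it corresponds to a vertex in $B_i$. Let $\ell(M)=(\ell_1(M),\dots,\ell_k(M))$. Then $\ell:V(H)\to\{0,1\}^k$ is an embedding of $H$ into the $k$-dimensional hypercube $Q_k$ as an induced subgraph: $\ell$ is injective, and for all $M,M'\in V(H)$, $MM'\in E(H)$ if and only if $\ell(M)$ and $\ell(M')$ differ in exactly one coordinate.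
   Context: A closed surface is a compact connected 2-dimensional manifold without boundary. A face of $G$ is the closure of a connected component of $\Sigma\setminus G$; $E(f)$ is the set of edges on the boundary of $f$, and $\mathcal F(G)$ is the set of all faces. A face is even if its boundary is a cycle of even length. The resonance graph $R(G;\mathcal F)$ has vertex set the perfect matchings of $G$, with $M_1\sim M_2$ iff $M_1\oplus M_2=E(f)$ for some $f\in\mathcal F$; an edge $MM'$ corresponds to face $f$ if $M\oplus M'=E(f)$. $E_i$ denotes the set of edges of $H$ corresponding to $f_i$, and $H\setminus E_i$ the graph obtained from $H$ by deleting $E_i$. The quotient graph $\mathcal H_i$ is obtained from $H$ by contracting all edges of $E(H)\setminus E_i$ and replacing parallel edges by single edges; its vertices correspond to the connected components of $H\setminus E_i$. $Q_k$ is the graph on binary strings of length $k$, two being adjacent iff they differ in exactly one position. *)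

theory Defs
  imports "HOL-Analysis.Analysis"
begin

section \<open>Undirected graphs\<close>

text \<open>A graph is a pair of a vertex set and a set of edges, an edge being the set of its ends.
  A singleton edge is a loop; quotient graphs may a priori have loops.\<close>

type_synonym 'v ugraph = "'v set \<times> 'v set set"

abbreviation verts :: "'v ugraph \<Rightarrow> 'v set" where "verts G \<equiv> fst G"
abbreviation edges :: "'v ugraph \<Rightarrow> 'v set set" where "edges G \<equiv> snd G"

definition finite_simple_graph :: "'v ugraph \<Rightarrow> bool" where
  "finite_simple_graph G \<longleftrightarrow>
     finite (verts G) \<and> (\<forall>e\<in>edges G. e \<subseteq> verts G \<and> card e = 2)"

definition component_of :: "'v ugraph \<Rightarrow> 'v \<Rightarrow> 'v set" where
  "component_of G v = {w \<in> verts G. (\<lambda>x y. {x, y} \<in> edges G)\<^sup>*\<^sup>* v w}"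

definition component_sets :: "'v ugraph \<Rightarrow> 'v set set" where
  "component_sets G = component_of G ` verts G"

definition connected_component_graph :: "'v ugraph \<Rightarrow> 'v ugraph \<Rightarrow> bool" where
  "connected_component_graph H G \<longleftrightarrow>
     (\<exists>C\<in>component_sets G. H = (C, {e \<in> edges G. e \<subseteq> C}))"

definition delete_edges :: "'v ugraph \<Rightarrow> 'v set set \<Rightarrow> 'v ugraph" where
  "delete_edges G S = (verts G, edges G - S)"

text \<open>Contraction of all edges outside \<open>S\<close>, with parallel edges identified. An edge of \<open>S\<close>
  with both ends in one component of \<open>delete_edges G S\<close> becomes a loop.\<close>

definition quotient_graph :: "'v ugraph \<Rightarrow> 'v set set \<Rightarrow> 'v set ugraph" where
  "quotient_graph G S =
     (component_sets (delete_edges G S),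
      {{C, D} | C D. C \<in> component_sets (delete_edges G S) \<and> D \<in> component_sets (delete_edges G S) \<and>
                     (\<exists>x\<in>C. \<exists>y\<in>D. {x, y} \<in> edges G \<inter> S)})"

definition bipartition :: "'v ugraph \<Rightarrow> 'v set \<Rightarrow> 'v set \<Rightarrow> bool" where
  "bipartition G A B \<longleftrightarrow>
     A \<union> B = verts G \<and> A \<inter> B = {} \<and> (\<forall>e\<in>edges G. \<exists>a\<in>A. \<exists>b\<in>B. e = {a, b})"

definition bipartite :: "'v ugraph \<Rightarrow> bool" where
  "bipartite G \<longleftrightarrow> (\<exists>A B. bipartition G A B)"

definition perfect_matching :: "'v ugraph \<Rightarrow> 'v set set \<Rightarrow> bool" where
  "perfect_matching G M \<longleftrightarrow> M \<subseteq> edges G \<and> (\<forall>v\<in>verts G. \<exists>!e. e \<in> M \<and> v \<in> e)"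

definition cycle_edges :: "'v list \<Rightarrow> 'v set set" where
  "cycle_edges vs = {{vs ! i, vs ! (Suc i mod length vs)} | i. i < length vs}"

definition cycle_in :: "'v ugraph \<Rightarrow> 'v list \<Rightarrow> bool" where
  "cycle_in G vs \<longleftrightarrow>
     distinct vs \<and> 3 \<le> length vs \<and> set vs \<subseteq> verts G \<and> cycle_edges vs \<subseteq> edges G"

definition hypercube :: "nat \<Rightarrow> nat list ugraph" where
  "hypercube k =
     (let W = {xs. length xs = k \<and> set xs \<subseteq> {0, 1}}
      in (W, {{xs, ys} | xs ys. xs \<in> W \<and> ys \<in> W \<and> card {i. i < k \<and> xs ! i \<noteq> ys ! i} = 1}))"

definition induced_subgraph_embedding :: "('v \<Rightarrow> 'w) \<Rightarrow> 'v ugraph \<Rightarrow> 'w ugraph \<Rightarrow> bool" where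
  "induced_subgraph_embedding h G K \<longleftrightarrow>
     h ` verts G \<subseteq> verts K \<and> inj_on h (verts G) \<and>
     (\<forall>u\<in>verts G. \<forall>v\<in>verts G. {u, v} \<in> edges G \<longleftrightarrow> {h u, h v} \<in> edges K)"


section \<open>Graphs embedded in closed surfaces\<close>

text \<open>Second countability is automatic for a compact locally Euclidean space.\<close>

definition closed_surface :: "'s topology \<Rightarrow> bool" where
  "closed_surface X \<longleftrightarrow>
     Hausdorff_space X \<and> compact_space X \<and> connected_space X \<and>
     (\<forall>x\<in>topspace X. \<exists>U. openin X U \<and> x \<in> U \<and>
        subtopology X U homeomorphic_space (euclidean :: (real ^ 2) topology))"

record ('v, 's) drawing =
  vpoint :: "'v \<Rightarrow> 's"
  ecurve :: "'v set \<Rightarrow> real \<Rightarrow> 's"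

definition embedded_in :: "'s topology \<Rightarrow> 'v ugraph \<Rightarrow> ('v, 's) drawing \<Rightarrow> bool" where
  "embedded_in X G D \<longleftrightarrow>
     vpoint D ` verts G \<subseteq> topspace X \<and> inj_on (vpoint D) (verts G) \<and>
     (\<forall>e\<in>edges G.
        embedding_map (top_of_set {0..1}) X (ecurve D e) \<and>
        {ecurve D e 0, ecurve D e 1} = vpoint D ` e \<and>
        ecurve D e ` {0<..<1} \<inter> vpoint D ` verts G = {}) \<and>
     (\<forall>e\<in>edges G. \<forall>e'\<in>edges G. e \<noteq> e' \<longrightarrow>
        ecurve D e ` {0<..<1} \<inter> ecurve D e' ` {0<..<1} = {})"

definition eset :: "('v, 's) drawing \<Rightarrow> 'v set \<Rightarrow> 's set" where
  "eset D e = ecurve D e ` {0..1}"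

definition point_set :: "'v ugraph \<Rightarrow> ('v, 's) drawing \<Rightarrow> 's set" where
  "point_set G D = vpoint D ` verts G \<union> (\<Union>e\<in>edges G. eset D e)"

definition regions :: "'s topology \<Rightarrow> 'v ugraph \<Rightarrow> ('v, 's) drawing \<Rightarrow> 's set set" where
  "regions X G D = connected_components_of (subtopology X (topspace X - point_set G D))"

definition faces :: "'s topology \<Rightarrow> 'v ugraph \<Rightarrow> ('v, 's) drawing \<Rightarrow> 's set set" where
  "faces X G D = (\<lambda>C. X closure_of C) ` regions X G D"

text \<open>The boundary of a face is the frontier of the open region of which it is the closure;
  removing the graph from a face gives back that region. (The frontier of the closed set itself
  would lose the edges that have the face on both sides.)\<close>

lemma closure_of_region_Diff:
  assumes "C \<in> regions X G D"
  shows "X closure_of C - point_set G D = C"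
proof -
  let ?S = "topspace X - point_set G D"
  have "closedin (subtopology X ?S) C"
    using assms closedin_connected_components_of unfolding regions_def by blast
  then have "?S \<inter> X closure_of C = C" and "C \<subseteq> ?S"
    by (auto simp: closedin_Int_closure_of inf.absorb2 closedin_subset dest: closedin_subset)
  then show ?thesis
    using closure_of_subset_topspace[of X C] by blast
qed

definition face_boundary ::
    "'s topology \<Rightarrow> 'v ugraph \<Rightarrow> ('v, 's) drawing \<Rightarrow> 's set \<Rightarrow> 's set" where
  "face_boundary X G D f = X frontier_of (f - point_set G D)"

definition face_edges ::
    "'s topology \<Rightarrow> 'v ugraph \<Rightarrow> ('v, 's) drawing \<Rightarrow> 's set \<Rightarrow> 'v set set" where
  "face_edges X G D f = {e \<in> edges G. eset D e \<subseteq> face_boundary X G D f}"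

definition even_face ::
    "'s topology \<Rightarrow> 'v ugraph \<Rightarrow> ('v, 's) drawing \<Rightarrow> 's set \<Rightarrow> bool" where
  "even_face X G D f \<longleftrightarrow>
     (\<exists>vs. cycle_in G vs \<and> even (length vs) \<and>
           face_boundary X G D f = (\<Union>e\<in>cycle_edges vs. eset D e))"


section \<open>Resonance graphs\<close>

definition resonance_graph ::
    "'s topology \<Rightarrow> 'v ugraph \<Rightarrow> ('v, 's) drawing \<Rightarrow> 's set set \<Rightarrow> 'v set set ugraph" where
  "resonance_graph X G D \<F> =
     ({M. perfect_matching G M},
      {{M, M'} | M M'. perfect_matching G M \<and> perfect_matching G M' \<and>
                       (\<exists>f\<in>\<F>. sym_diff M M' = face_edges X G D f)})"

definition corresponding_edges ::
    "'s topology \<Rightarrow> 'v ugraph \<Rightarrow> ('v, 's) drawing \<Rightarrow> 'v set set ugraph \<Rightarrow> 's set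
     \<Rightarrow> 'v set set set set" where
  "corresponding_edges X G D H f =
     {{M, M'} | M M'. {M, M'} \<in> edges H \<and> sym_diff M M' = face_edges X G D f}"

text \<open>Only faces of \<open>\<F>\<close> count: a face outside \<open>\<F>\<close> may have the same edge set as one in \<open>\<F>\<close>
  (e.g. when the graph is a cycle in the sphere).\<close>

definition corresponding_faces ::
    "'s topology \<Rightarrow> 'v ugraph \<Rightarrow> ('v, 's) drawing \<Rightarrow> 's set set \<Rightarrow> 'v set set ugraph
     \<Rightarrow> 's set set" where
  "corresponding_faces X G D \<F> H = {f \<in> \<F>. corresponding_edges X G D H f \<noteq> {}}"

definition side_label ::
    "'v ugraph \<Rightarrow> 'v set set \<Rightarrow> 'v set set \<Rightarrow> 'v \<Rightarrow> nat" where
  "side_label H S A x = (if component_of (delete_edges H S) x \<in> A then 0 else 1)"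

end

theory Submission
  imports Defs "HOL-Complex_Analysis.Contour_Integration"
begin

text \<open>
  Everything rests on the independence over the two-element field of the edge sets of the faces
  in \<open>\<F>\<close>. Suppose a nonempty finite set \<open>S\<close> of even faces leaves no edge on exactly one face of
  \<open>S\<close>. An edge locally has at most two sides, so near an interior point of an edge on two faces of
  \<open>S\<close> the surface is covered by these two faces. Hence the union of \<open>S\<close> is open and closed in the
  surface without the vertices, which is connected, and \<open>S\<close> consists of all faces.

  Consequently, for a fixed base matching \<open>M0\<close> of \<open>H\<close>, every \<open>M\<close> in \<open>H\<close> determines a unique set
  \<open>P M\<close> of faces whose edge sets sum to the symmetric difference of \<open>M0\<close> and \<open>M\<close>. Along an edge of
  \<open>H\<close> that corresponds to \<open>f\<close>, both \<open>P\<close> and the labels change exactly at \<open>f\<close>; so two matchings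
  have different labels at \<open>f\<close> iff \<open>f\<close> lies in exactly one of their sets \<open>P\<close>.
\<close>

section \<open>Two-sidedness of arcs\<close>

text \<open>The ends of \<open>c\<close> cut the circle into two arcs \<open>u\<close> and
  \<open>d\<close>, which form a theta curve together with \<open>c\<close>. The open disc without
  \<open>c\<close> is the union of the insides of two Jordan curves, each made of \<open>c\<close>
  and one circular arc, and such insides are connected.\<close>

lemma crosscut_of_disc_two_sides:
  fixes c :: "real \<Rightarrow> complex"
  assumes "0 < r" "arc c"
    and ends: "pathstart c \<in> sphere x r" "pathfinish c \<in> sphere x r"
    and inner: "path_image c - {pathstart c, pathfinish c} \<subseteq> ball x r"
  obtains U V where "connected U" "connected V" "U \<union> V = ball x r - path_image c"
proof -
  define a b where "a = pathstart c" and "b = pathfinish c"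
  have "a \<noteq> b"
    unfolding a_def b_def using arc_distinct_ends[OF \<open>arc c\<close>] by simp
  obtain u d where ud: "arc u" "arc d" "pathstart u = a" "pathfinish u = b"
      "pathstart d = b" "pathfinish d = a" "path_image u \<inter> path_image d = {a,b}"
      "path_image u \<union> path_image d = path_image (circlepath x r)"
    by (rule exists_double_arc[of "circlepath x r" a b])
       (use ends \<open>0 < r\<close> \<open>a \<noteq> b\<close> in \<open>auto simp: simple_path_circlepath a_def b_def\<close>)
  have circ: "path_image u \<union> path_image d = sphere x r"
    using ud \<open>0 < r\<close> by simp
  have abc: "{a,b} \<subseteq> path_image c"
    by (simp add: a_def b_def pathstart_in_path_image pathfinish_in_path_image)
  have sph: "path_image c \<inter> sphere x r = {a,b}"
    using inner ends abc unfolding a_def b_def by fastforce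
  have uc: "path_image u \<inter> path_image c = {a,b}" and dc: "path_image d \<inter> path_image c = {a,b}"
    using sph circ ud(7) by blast+
  have inside_circ: "inside (path_image u \<union> path_image (reversepath d)) = ball x r"
    using inside_frontier_eq_interior[of "cball x r"] circ by (simp add: frontier_cball)
  \<comment> \<open>The midpoint is a point of \<open>c\<close> other than its ends, hence inside
    the circle, as the splitting of the theta curve requires.\<close>
  have "c (1/2) \<in> path_image c" "c (1/2) \<noteq> a" "c (1/2) \<noteq> b"
    using \<open>arc c\<close> unfolding a_def b_def path_image_def pathstart_def pathfinish_def arc_def
    by (auto dest: inj_onD)
  then have ne: "path_image c \<inter> inside (path_image u \<union> path_image (reversepath d)) \<noteq> {}"
    using inner inside_circ unfolding a_def b_def by blast
  have split: "inside (path_image u \<union> path_image c) \<union> inside (path_image (reversepath d) \<union> path_image c) \<union>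
           (path_image c - {a,b}) = ball x r"
    unfolding inside_circ[symmetric]
    by (rule split_inside_simple_closed_curve[of u a b "reversepath d" c])
       (use ne ud uc dc \<open>a \<noteq> b\<close> \<open>arc c\<close> in \<open>simp_all add: arc_imp_simple_path arc_reversepath a_def b_def\<close>)
  have conn: "connected (inside (path_image v \<union> path_image c))"
    if "arc v" "pathstart v = a" "pathfinish v = b" "path_image v \<inter> path_image c = {a,b}" for v
  proof -
    have "simple_path (v +++ reversepath c)"
      by (rule simple_path_join_loop) (use that \<open>arc c\<close> in \<open>auto simp: a_def b_def arc_reversepath\<close>)
    then have "connected (inside (path_image (v +++ reversepath c)))"
      using that by (intro Jordan_inside_outside[THEN conjunct2, THEN conjunct2, THEN conjunct1])
        (auto simp: a_def b_def)
    then show ?thesis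
      using that by (simp add: path_image_join b_def)
  qed
  have "inside (path_image u \<union> path_image c) \<union> inside (path_image (reversepath d) \<union> path_image c)
      = ball x r - path_image c"
  proof -
    have "inside (path_image v \<union> path_image c) \<inter> path_image c = {}" for v
      using inside_no_overlap[of "path_image v \<union> path_image c"] by blast
    moreover have "a \<notin> ball x r" "b \<notin> ball x r"
      using ends by (auto simp: a_def b_def)
    ultimately show ?thesis
      using split by blast
  qed
  moreover have "connected (inside (path_image u \<union> path_image c))"
    using conn ud uc by blast
  moreover have "connected (inside (path_image (reversepath d) \<union> path_image c))"
    using conn[of "reversepath d"] ud dc by (simp add: arc_reversepath)
  ultimately show ?thesis
    using that by blast
qed

lemma path_first_exit_of_ball:
  fixes g :: "real \<Rightarrow> 'a::euclidean_space"
  assumes "path g" "pathstart g \<in> ball x r" "pathfinish g \<notin> ball x r"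
  obtains u where "0 < u" "u \<le> 1" "\<And>y. 0 \<le> y \<Longrightarrow> y < u \<Longrightarrow> g y \<in> ball x r" "g u \<in> sphere x r"
proof -
  obtain u where u: "0 \<le> u" "u \<le> 1"
                "\<And>y. 0 \<le> y \<and> y < u \<Longrightarrow> g y \<in> interior (ball x r)"
                "g u \<notin> interior (ball x r)" "u = 0 \<or> g u \<in> closure (ball x r)"
    using subpath_to_frontier_explicit[OF assms(1,3)] by blast
  have "u \<noteq> 0"
    using u(4) assms(2) by (auto simp: pathstart_def)
  moreover have "0 < r"
    using assms(2) by (metis mem_ball zero_le_dist order_le_less_trans)
  then have "g u \<in> sphere x r"
    using u(4,5) \<open>u \<noteq> 0\<close> by auto
  ultimately show ?thesis
    using u that[of u] by force
qed

text \<open>The piece of the arc around parameter \<open>c\<close>, up to where it first reaches the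
  circle in either direction, is a crosscut with two connected sides, and two of three points lie on
  the same side. The three-point form avoids naming the sides, which further returns of the arc into
  the disc may cut into more pieces.\<close>

lemma arc_locally_two_sided:
  fixes g :: "real \<Rightarrow> complex"
  assumes "arc g" and c: "0 < c" "c < 1" and "0 < r"
    and ends: "pathstart g \<notin> ball (g c) r" "pathfinish g \<notin> ball (g c) r"
  obtains \<delta> where "0 < \<delta>" "\<delta> \<le> r"
    "\<And>p q w. p \<in> ball (g c) \<delta> - path_image g \<Longrightarrow> q \<in> ball (g c) \<delta> - path_image g \<Longrightarrow>
        w \<in> ball (g c) \<delta> - path_image g \<Longrightarrow>
        connected_component (ball (g c) r - path_image g) p q \<or>
        connected_component (ball (g c) r - path_image g) p w \<or>
        connected_component (ball (g c) r - path_image g) q w"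
proof -
  define x where "x = g c"
  have g: "path g" "continuous_on {0..1} g" "inj_on g {0..1}"
    using \<open>arc g\<close> by (auto simp: arc_def path_def)
  have ends': "g 0 \<notin> ball x r" "g 1 \<notin> ball x r"
    using ends by (auto simp: x_def pathstart_def pathfinish_def)
  obtain u where u: "0 < u" "u \<le> 1" "\<And>y. 0 \<le> y \<Longrightarrow> y < u \<Longrightarrow> subpath c 1 g y \<in> ball x r"
      "subpath c 1 g u \<in> sphere x r"
    by (rule path_first_exit_of_ball[of "subpath c 1 g" x r])
       (use c ends' g \<open>0 < r\<close> in \<open>auto simp: x_def\<close>)
  obtain v where v: "0 < v" "v \<le> 1" "\<And>y. 0 \<le> y \<Longrightarrow> y < v \<Longrightarrow> subpath c 0 g y \<in> ball x r"
      "subpath c 0 g v \<in> sphere x r"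
    by (rule path_first_exit_of_ball[of "subpath c 0 g" x r])
       (use c ends' g \<open>0 < r\<close> in \<open>auto simp: x_def\<close>)
  define s t where "s = c - c * v" and "t = (1 - c) * u + c"
  have st: "0 \<le> s" "s < c" "c < t" "t \<le> 1"
  proof -
    have "c * v \<le> c" "(1 - c) * u \<le> 1 - c" "0 < c * v" "0 < (1 - c) * u"
      using c u(1,2) v(1,2) by (auto intro!: mult_left_le)
    then show "0 \<le> s" "s < c" "c < t" "t \<le> 1"
      unfolding s_def t_def by linarith+
  qed
  have gst: "g s \<in> sphere x r" "g t \<in> sphere x r"
    using u(4) v(4) by (auto simp: subpath_def s_def t_def)
  have right: "g y \<in> ball x r" if "c \<le> y" "y < t" for y
  proof -
    have "subpath c 1 g ((y - c) / (1 - c)) = g y"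
      using c by (simp add: subpath_def)
    moreover have "0 \<le> (y - c) / (1 - c)" "(y - c) / (1 - c) < u"
      using that c by (auto simp: t_def pos_divide_less_eq algebra_simps)
    ultimately show ?thesis
      using u(3) by metis
  qed
  have left: "g y \<in> ball x r" if "s < y" "y \<le> c" for y
  proof -
    have "subpath c 0 g ((c - y) / c) = g y"
      using c by (simp add: subpath_def)
    moreover have "0 \<le> (c - y) / c" "(c - y) / c < v"
      using that c by (auto simp: s_def pos_divide_less_eq algebra_simps)
    ultimately show ?thesis
      using v(3) by metis
  qed
  have inn: "g y \<in> ball x r" if "s < y" "y < t" for y
    using left[of y] right[of y] that by linarith
  define h where "h = subpath s t g"
  have him: "path_image h = g ` {s..t}"
    using st by (simp add: h_def path_image_subpath)
  have "arc h"
    unfolding h_def using st \<open>arc g\<close> by (intro arc_subpath_arc) auto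
  obtain U V where UV: "connected U" "connected V" "U \<union> V = ball x r - path_image h"
  proof (rule crosscut_of_disc_two_sides[OF \<open>0 < r\<close> \<open>arc h\<close>])
    show "path_image h - {pathstart h, pathfinish h} \<subseteq> ball x r"
    proof
      fix z assume z: "z \<in> path_image h - {pathstart h, pathfinish h}"
      then obtain y where "y \<in> {s..t}" "z = g y"
        by (auto simp: him)
      moreover from this z have "y \<noteq> s" "y \<noteq> t"
        by (auto simp: h_def)
      ultimately show "z \<in> ball x r"
        using inn by auto
    qed
  qed (use gst in \<open>auto simp: h_def\<close>)
  \<comment> \<open>The remainder of the arc is compact and, by injectivity, misses
    \<open>x\<close>; so a small disc about \<open>x\<close> meets \<open>g\<close> only in
    \<open>h\<close>.\<close>
  define rest where "rest = g ` {0..s} \<union> g ` {t..1}"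
  have "compact rest"
    unfolding rest_def using st
    by (intro compact_Un compact_continuous_image continuous_on_subset[OF g(2)]) auto
  have "x \<notin> rest"
  proof
    assume "x \<in> rest"
    then obtain y where "y \<in> {0..s} \<union> {t..1}" "g y = g c"
      unfolding rest_def x_def by (metis Un_iff image_iff)
    moreover from this have "y = c"
      using st c by (intro inj_onD[OF g(3)]) auto
    ultimately show False
      using st by auto
  qed
  then obtain e where e: "0 < e" "ball x e \<subseteq> - rest"
    using \<open>compact rest\<close> by (meson ComplI compact_imp_closed open_Compl openE)
  have img: "path_image g = path_image h \<union> rest"
  proof -
    have "{0..1} = {s..t} \<union> ({0..s} \<union> {t..1})"
      using st by auto
    then have "g ` {0..1} = g ` {s..t} \<union> (g ` {0..s} \<union> g ` {t..1})"
      by (metis image_Un)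
    then show ?thesis
      unfolding him rest_def by (simp add: path_image_def)
  qed
  define \<delta> where "\<delta> = min e r"
  have \<delta>: "0 < \<delta>" "\<delta> \<le> r" "ball x \<delta> \<subseteq> - rest"
    using e \<open>0 < r\<close> by (auto simp: \<delta>_def)
  define S T where "S = sphere x r \<union> path_image h" and "T = rest \<union> - ball x r"
  have ST: "S \<inter> T = sphere x r"
  proof -
    have "g y \<in> sphere x r" if y: "y \<in> {s..t}" "g y \<in> T" for y
    proof (cases "y = s \<or> y = t")
      case False
      then have yb: "g y \<in> ball x r"
        using inn y by auto
      then obtain z where z: "z \<in> {0..s} \<union> {t..1}" "g z = g y"
        using y(2) unfolding T_def rest_def by (metis ComplD UnE image_iff Un_iff)
      then have "z = y"
        using st y by (intro inj_onD[OF g(3)]) auto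
      then show ?thesis
        using z y False st by auto
    qed (use gst in auto)
    then show ?thesis
      unfolding S_def him by (auto simp: T_def)
  qed
  \<comment> \<open>\<open>g\<close> may re-enter the disc outside \<open>h\<close>. Adding the exterior of the disc to the re-entering pieces
    makes the intersection with \<open>S\<close> a circle, so that Janiszewski's theorem applies.\<close>
  have joined: "connected_component (ball x r - path_image g) p q"
    if pq: "p \<in> ball x \<delta>" "q \<in> ball x \<delta>" and W: "connected W" "W \<subseteq> ball x r - path_image h" "p \<in> W" "q \<in> W" for p q W
  proof -
    have "connected_component (- (S \<union> T)) p q"
    proof (rule Janiszewski)
      show "compact S"
        unfolding S_def using compact_path_image[OF arc_imp_path[OF \<open>arc h\<close>]] by (intro compact_Un) auto
      show "closed T"
        unfolding T_def using \<open>compact rest\<close> by (auto intro: compact_imp_closed)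
      show "connected (S \<inter> T)"
        unfolding ST by (rule connected_sphere) simp
      show "connected_component (- S) p q"
        using W unfolding S_def by (intro connected_componentI[of W]) auto
      show "connected_component (- T) p q"
        using pq \<delta> unfolding T_def by (intro connected_componentI[of "ball x \<delta>"]) auto
    qed
    moreover have "- (S \<union> T) \<subseteq> ball x r - path_image g"
      unfolding S_def T_def img by auto
    ultimately show ?thesis
      by (rule connected_component_of_subset)
  qed
  show ?thesis
  proof (rule that[of \<delta>])
    fix p q w
    assume pqw: "p \<in> ball (g c) \<delta> - path_image g" "q \<in> ball (g c) \<delta> - path_image g"
        "w \<in> ball (g c) \<delta> - path_image g"
    \<comment> \<open>Pigeonhole: two of the three points lie together in \<open>U\<close> or
      together in \<open>V\<close>, and \<open>joined\<close> applies to them.\<close>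
    then have "p \<in> U \<union> V" "q \<in> U \<union> V" "w \<in> U \<union> V"
      using \<delta> unfolding UV(3) img x_def by auto
    moreover have "U \<subseteq> ball x r - path_image h" "V \<subseteq> ball x r - path_image h"
      using UV(3) by auto
    ultimately show "connected_component (ball (g c) r - path_image g) p q \<or>
        connected_component (ball (g c) r - path_image g) p w \<or>
        connected_component (ball (g c) r - path_image g) q w"
      using joined[of p q U] joined[of p w U] joined[of q w U]
        joined[of p q V] joined[of p w V] joined[of q w V] UV(1,2) pqw
      unfolding x_def by blast
  qed (use \<delta> in auto)
qed

section \<open>Closed surfaces\<close>

text \<open>Charts are inverted and defined on the whole complex plane, because the planar
  separation theorems are applied there.\<close>

lemma closed_surface_chart:
  assumes "closed_surface X" "x \<in> topspace X"
  obtains \<psi> :: "complex \<Rightarrow> 's" and z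
  where "continuous_map euclidean X \<psi>" "open_map euclidean X \<psi>" "inj \<psi>" "\<psi> z = x"
proof -
  obtain U where U: "openin X U" "x \<in> U"
      "subtopology X U homeomorphic_space (euclidean :: (real ^ 2) topology)"
    using assms unfolding closed_surface_def by blast
  have "(euclidean :: (real ^ 2) topology) homeomorphic_space (euclidean :: complex topology)"
  proof -
    obtain f g where "homeomorphism (UNIV :: (real ^ 2) set) (UNIV :: complex set) f g"
      using homeomorphic_UNIV_UNIV[where 'a = "real ^ 2" and 'b = complex]
      by (auto simp: homeomorphic_def)
    then show ?thesis
      unfolding homeomorphic_space_def homeomorphic_maps_def homeomorphism_def by auto
  qed
  then obtain \<phi> \<psi> where "homeomorphic_maps (subtopology X U) (euclidean :: complex topology) \<phi> \<psi>"
    using U(3) homeomorphic_space_trans unfolding homeomorphic_space_def by blast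
  then have \<psi>: "homeomorphic_map (euclidean :: complex topology) (subtopology X U) \<psi>"
    using homeomorphic_maps_map homeomorphic_maps_sym by blast
  have "U \<subseteq> topspace X"
    using U(1) openin_subset by blast
  then have im: "range \<psi> = U"
    using homeomorphic_imp_surjective_map[OF \<psi>] by auto
  show ?thesis
  proof (rule that[of \<psi> "inv \<psi> x"])
    show "continuous_map euclidean X \<psi>"
      using \<psi> homeomorphic_imp_continuous_map continuous_map_into_fulltopology by blast
    show "open_map euclidean X \<psi>"
      using homeomorphic_imp_open_map[OF \<psi>] U(1) unfolding open_map_def
      using openin_trans_full by blast
    show "inj \<psi>"
      using homeomorphic_imp_injective_map[OF \<psi>] by simp
    show "\<psi> (inv \<psi> x) = x"
      using U(2) im by (metis f_inv_into_f)
  qed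
qed

text \<open>Points are removed one at a time. A punctured disc is connected, so it lies in one part
  of any separation of the punctured space; returning the point to that part would separate the
  space before the puncture.\<close>

lemma connectedin_closed_surface_Diff_finite:
  assumes surf: "closed_surface X" and "finite V"
  shows "connectedin X (topspace X - V)"
  using \<open>finite V\<close>
proof (induction V rule: finite_induct)
  case empty
  then show ?case
    using surf by (simp add: closed_surface_def connectedin_topspace)
next
  case (insert v V)
  define Y where "Y = topspace X - V"
  show ?case
  proof (cases "v \<in> topspace X")
    case False
    then have "topspace X - insert v V = topspace X - V"
      by blast
    then show ?thesis
      using insert.IH by simp
  next
    case True
    have opn: "openin X (topspace X - W)" if "finite W" for W
    proof -
      have "closedin X (W \<inter> topspace X)"
        using that surf closedin_Hausdorff_finite unfolding closed_surface_def by blast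
      moreover have "topspace X - W = topspace X - W \<inter> topspace X"
        by blast
      ultimately show ?thesis
        by (metis openin_diff openin_topspace)
    qed
    obtain \<psi> :: "complex \<Rightarrow> _" and z where \<psi>: "continuous_map euclidean X \<psi>"
        "open_map euclidean X \<psi>" "inj \<psi>" "\<psi> z = v"
      using closed_surface_chart[OF surf True] by blast
    have "open {w. \<psi> w \<in> Y}"
      using openin_continuous_map_preimage[OF \<psi>(1) opn[OF insert.hyps(1)]] by (simp add: Y_def)
    moreover have "\<psi> z \<in> Y"
      using \<psi>(4) True insert.hyps by (simp add: Y_def)
    ultimately obtain r where r: "0 < r" "ball z r \<subseteq> {w. \<psi> w \<in> Y}"
      by (metis mem_Collect_eq openE)
    define N where "N = \<psi> ` ball z r"
    have N: "openin X N" "v \<in> N" "N \<subseteq> Y"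
      using \<psi> r unfolding N_def open_map_def by auto
    have "N - {v} = \<psi> ` (ball z r - {z})"
      using \<psi>(3,4) unfolding N_def by (auto dest: injD)
    then have Nv: "connectedin X (N - {v})"
      using connected_punctured_ball[of z r] connectedin_continuous_map_image[OF \<psi>(1)] by simp
    \<comment> \<open>\<open>E2\<close> is the part that misses the punctured neighbourhood. Giving
      all of \<open>N\<close> to the other part turns a separation of \<open>Y - {v}\<close> into
      one of \<open>Y\<close>. The roles of the two parts are exchanged in the second use.\<close>
    have absurd: False
      if E: "openin X E1" "openin X E2" "Y - {v} \<subseteq> E1 \<union> E2" "E1 \<inter> E2 \<inter> (Y - {v}) = {}"
         "E2 \<inter> (Y - {v}) \<noteq> {}" "E2 \<inter> (N - {v}) = {}" for E1 E2
    proof -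
      have Yv: "openin X (Y - {v})"
        using opn[of "insert v V"] insert.hyps(1) unfolding Y_def by (metis Diff_insert finite_insert)
      define F1 F2 where "F1 = E1 \<inter> (Y - {v}) \<union> N" and "F2 = E2 \<inter> (Y - {v})"
      have "openin X F1" "openin X F2"
        unfolding F1_def F2_def using E(1,2) Yv N(1) by (auto intro: openin_Int openin_Un)
      moreover have "Y \<subseteq> F1 \<union> F2" "F1 \<inter> F2 \<inter> Y = {}" "F1 \<inter> Y \<noteq> {}" "F2 \<inter> Y \<noteq> {}"
        unfolding F1_def F2_def using E(3-6) N by blast+
      ultimately show False
        using insert.IH unfolding connectedin Y_def by blast
    qed
    have "connectedin X (Y - {v})"
    proof (rule ccontr)
      assume "\<not> connectedin X (Y - {v})"
      moreover have "Y - {v} \<subseteq> topspace X"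
        by (auto simp: Y_def)
      ultimately obtain E1 E2 where E: "openin X E1" "openin X E2" "Y - {v} \<subseteq> E1 \<union> E2"
          "E1 \<inter> E2 \<inter> (Y - {v}) = {}" "E1 \<inter> (Y - {v}) \<noteq> {}" "E2 \<inter> (Y - {v}) \<noteq> {}"
        unfolding connectedin by blast
      have "E1 \<inter> (N - {v}) = {} \<or> E2 \<inter> (N - {v}) = {}"
        using Nv E(1-4) N(3) unfolding connectedin by blast
      then show False
        using absurd[of E1 E2] absurd[of E2 E1] E by blast
    qed
    moreover have "topspace X - insert v V = Y - {v}"
      by (auto simp: Y_def)
    ultimately show ?thesis
      by simp
  qed
qed

text \<open>Surfaces are locally connected: the chart image of a small disc about a point of
  \<open>C\<close> is connected and lies in \<open>Y\<close>, hence in \<open>C\<close>.\<close>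

lemma closed_surface_open_component:
  assumes surf: "closed_surface X" and "openin X Y"
    and C: "C \<in> connected_components_of (subtopology X Y)"
  shows "openin X C"
proof (subst openin_subopen, intro ballI)
  fix x assume "x \<in> C"
  have CY: "C \<subseteq> Y \<inter> topspace X"
    using connected_components_of_subset[OF C] by auto
  then have x: "x \<in> topspace X" "x \<in> Y"
    using \<open>x \<in> C\<close> by auto
  obtain \<psi> :: "complex \<Rightarrow> _" and z where \<psi>: "continuous_map euclidean X \<psi>"
      "open_map euclidean X \<psi>" "inj \<psi>" "\<psi> z = x"
    using closed_surface_chart[OF surf x(1)] by blast
  have "open {w. \<psi> w \<in> Y}"
    using openin_continuous_map_preimage[OF \<psi>(1) \<open>openin X Y\<close>] by simp
  then obtain r where r: "0 < r" "ball z r \<subseteq> {w. \<psi> w \<in> Y}"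
    using x \<psi>(4) by (metis mem_Collect_eq openE)
  have "connectedin X (\<psi> ` ball z r)"
    using connectedin_continuous_map_image[OF \<psi>(1)] by simp
  then have "connectedin (subtopology X Y) (\<psi> ` ball z r)"
    using r by (auto simp: connectedin_subtopology)
  moreover have xin: "x \<in> \<psi> ` ball z r"
    using r \<psi>(4) by (metis centre_in_ball imageI)
  ultimately have "\<psi> ` ball z r \<subseteq> C"
    using connected_components_of_maximal[OF C] \<open>x \<in> C\<close> by (metis disjnt_iff)
  then show "\<exists>T. openin X T \<and> x \<in> T \<and> T \<subseteq> C"
    using \<psi>(2) xin unfolding open_map_def by (metis open_ball open_openin)
qed

text \<open>The planar three-point property is carried over by a chart. Nearby points of the two
  regions cannot be joined off the arc, so every other nearby point off the arc is joined to one of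
  them. In the application \<open>Z\<close> is the rest of the drawing.\<close>

lemma embedded_arc_two_sided:
  assumes surf: "closed_surface X"
    and emb: "embedding_map (top_of_set {0..1::real}) X \<gamma>"
    and Z: "closedin X Z" "\<gamma> c \<notin> Z" and c: "0 < c" "c < 1"
    and R: "R\<^sub>1 \<in> connected_components_of (subtopology X (topspace X - (Z \<union> \<gamma> ` {0..1})))"
      "R\<^sub>2 \<in> connected_components_of (subtopology X (topspace X - (Z \<union> \<gamma> ` {0..1})))"
      "R\<^sub>1 \<noteq> R\<^sub>2" "\<gamma> c \<in> X closure_of R\<^sub>1" "\<gamma> c \<in> X closure_of R\<^sub>2"
  obtains N where "openin X N" "\<gamma> c \<in> N" "N \<subseteq> R\<^sub>1 \<union> R\<^sub>2 \<union> \<gamma> ` {0<..<1}"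
proof -
  define Y where "Y = subtopology X (topspace X - (Z \<union> \<gamma> ` {0..1}))"
  have \<gamma>: "continuous_map (top_of_set {0..1}) X \<gamma>" "inj_on \<gamma> {0..1}"
    using emb homeomorphic_imp_injective_map continuous_map_into_fulltopology
    by (fastforce simp: embedding_map_def dest: homeomorphic_imp_continuous_map)+
  have x: "\<gamma> c \<in> topspace X"
    using R(4) by (simp add: in_closure_of)
  obtain \<psi> :: "complex \<Rightarrow> _" and z where \<psi>: "continuous_map euclidean X \<psi>"
      "open_map euclidean X \<psi>" "inj \<psi>" "\<psi> z = \<gamma> c"
    using closed_surface_chart[OF surf x] by blast
  have "openin X (range \<psi>)"
    using \<psi>(2) by (simp add: open_map_def)
  then have "openin (top_of_set {0..1}) {t \<in> {0..1}. \<gamma> t \<in> range \<psi>}"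
    using openin_continuous_map_preimage[OF \<gamma>(1)] by simp
  then obtain T where T: "open T" "{t \<in> {0..1}. \<gamma> t \<in> range \<psi>} = {0..1} \<inter> T"
    by (auto simp: openin_open)
  have "c \<in> T \<inter> {0<..<1}"
    using T(2) c \<psi>(4) by (metis (mono_tags, lifting) Int_iff atLeastAtMost_iff greaterThanLessThan_iff
        less_eq_real_def mem_Collect_eq rangeI)
  then obtain \<eta> where \<eta>: "0 < \<eta>" "cball c \<eta> \<subseteq> T \<inter> {0<..<1}"
    using T(1) by (meson open_Int open_contains_cball open_greaterThanLessThan)
  define a b where "a = c - \<eta>" and "b = c + \<eta>"
  have "a \<in> cball c \<eta>" "b \<in> cball c \<eta>"
    using \<eta>(1) by (auto simp: a_def b_def dist_real_def)
  then have "a \<in> {0<..<1}" "b \<in> {0<..<1}"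
    using \<eta>(2) by blast+
  then have ab: "0 < a" "a < c" "c < b" "b < 1"
    using \<eta>(1) by (auto simp: a_def b_def)
  have chart: "\<gamma> t \<in> range \<psi>" if "t \<in> {a..b}" for t
  proof -
    have "t \<in> cball c \<eta>"
      using that by (auto simp: a_def b_def dist_real_def)
    then have "t \<in> {0..1} \<inter> T"
      using \<eta>(2) by auto
    then show ?thesis
      using T(2) by blast
  qed
  \<comment> \<open>Only the piece of the curve over \<open>[a, b]\<close> is known to lie in the
    chart. \<open>k\<close> rescales this piece to the unit interval, with \<open>c\<close> at
    \<open>1/2\<close>, and \<open>g\<close> is its image in the plane.\<close>
  define k where "k u = a + u * (b - a)" for u
  have k: "k u \<in> {a..b}" if "u \<in> {0..1}" for u
  proof -
    have "u * (b - a) \<le> b - a" "0 \<le> u * (b - a)"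
      using that ab by (auto intro: mult_left_le_one_le)
    then show ?thesis
      unfolding k_def by auto
  qed
  have k_onto: "\<exists>u\<in>{0..1}. k u = t" if "t \<in> {a..b}" for t
    using that ab by (intro bexI[of _ "(t - a) / (b - a)"]) (auto simp: k_def)
  have k_half: "k (1/2) = c"
    by (simp add: k_def a_def b_def)
  have k01: "k u \<in> {0..1}" if "u \<in> {0..1}" for u
    using k[OF that] ab by auto
  define g where "g u = inv \<psi> (\<gamma> (k u))" for u
  have \<psi>g: "\<psi> (g u) = \<gamma> (k u)" if "u \<in> {0..1}" for u
    unfolding g_def using chart[OF k[OF that]] by (rule f_inv_into_f)
  have "arc g"
    unfolding arc_def path_def
  proof
    have cont: "continuous_map (top_of_set {0..1}) X (\<lambda>u. \<gamma> (k u))"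
    proof -
      have "continuous_map (top_of_set {0..1}) (top_of_set {0..1}) k"
        using k01 unfolding k_def by (auto intro!: continuous_intros)
      from continuous_map_compose[OF this \<gamma>(1)] show ?thesis
        by (simp only: comp_def)
    qed
    have "openin (top_of_set {0..1}) {u \<in> {0..1}. g u \<in> Q}" if "open Q" for Q
    proof -
      have "openin X (\<psi> ` Q)"
        using \<psi>(2) that by (simp add: open_map_def)
      then have "openin (top_of_set {0..1}) {u \<in> {0..1}. \<gamma> (k u) \<in> \<psi> ` Q}"
        using openin_continuous_map_preimage[OF cont] by simp
      moreover have "{u \<in> {0..1}. \<gamma> (k u) \<in> \<psi> ` Q} = {u \<in> {0..1}. g u \<in> Q}"
        by (rule Collect_cong) (metis \<psi>g \<psi>(3) inj_image_mem_iff)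
      ultimately show ?thesis
        by simp
    qed
    then have "continuous_map (top_of_set {0..1}) euclidean g"
      by (simp add: continuous_map)
    then show "continuous_on {0..1} g"
      by simp
    show "inj_on g {0..1}"
    proof (rule inj_onI)
      fix u v assume uv: "u \<in> {0..1}" "v \<in> {0..1}" "g u = g v"
      then have "\<gamma> (k u) = \<gamma> (k v)"
        using \<psi>g by metis
      then have "k u = k v"
        using \<gamma>(2) k01 uv by (meson inj_onD)
      then show "u = v"
        using ab by (simp add: k_def)
    qed
  qed
  have gz: "g (1/2) = z"
    unfolding g_def k_half using \<psi>(3,4) by (metis inv_f_f)
  \<comment> \<open>Everything to be kept out of the disc. It contains the points at
    \<open>a\<close> and \<open>b\<close>, so both ends of \<open>g\<close> fall outside the disc,
    as the planar lemma demands.\<close>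
  define rest where "rest = \<gamma> ` {0..a} \<union> \<gamma> ` {b..1} \<union> Z"
  have "closedin X rest"
  proof -
    have "closedin X (\<gamma> ` {p..q})" if "0 \<le> p" "q \<le> 1" for p q
    proof -
      have "compactin (top_of_set {0..1}) {p..q}"
        using that by (simp add: compactin_subtopology)
      then show ?thesis
        using image_compactin[OF _ \<gamma>(1)] surf compactin_imp_closedin
        unfolding closed_surface_def by blast
    qed
    then show ?thesis
      unfolding rest_def using Z ab by (intro closedin_Un) auto
  qed
  have "\<gamma> c \<notin> rest"
  proof -
    have "\<gamma> c \<noteq> \<gamma> t" if "t \<in> {0..a} \<union> {b..1}" for t
      using that ab by (intro notI) (auto dest!: inj_onD[OF \<gamma>(2)])
    then show ?thesis
      using Z(2) unfolding rest_def by blast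
  qed
  have "open {w. \<psi> w \<in> topspace X - rest}"
    using openin_continuous_map_preimage[OF \<psi>(1), of "topspace X - rest"] \<open>closedin X rest\<close> by auto
  then obtain r where r: "0 < r" "ball z r \<subseteq> {w. \<psi> w \<in> topspace X - rest}"
    using x \<psi>(4) \<open>\<gamma> c \<notin> rest\<close> by (metis (mono_tags, lifting) DiffI mem_Collect_eq openE)
  have ends: "pathstart g \<notin> ball (g (1/2)) r" "pathfinish g \<notin> ball (g (1/2)) r"
  proof -
    have "\<psi> (g 0) = \<gamma> a" "\<psi> (g 1) = \<gamma> b"
      using \<psi>g[of 0] \<psi>g[of 1] by (auto simp: k_def)
    then have "\<psi> (g 0) \<in> rest" "\<psi> (g 1) \<in> rest"
      unfolding rest_def using ab by auto
    then show "pathstart g \<notin> ball (g (1/2)) r" "pathfinish g \<notin> ball (g (1/2)) r"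
      using r(2) unfolding gz pathstart_def pathfinish_def by blast+
  qed
  obtain \<delta> where \<delta>: "0 < \<delta>" "\<delta> \<le> r"
    "\<And>p q w. p \<in> ball z \<delta> - path_image g \<Longrightarrow> q \<in> ball z \<delta> - path_image g \<Longrightarrow>
        w \<in> ball z \<delta> - path_image g \<Longrightarrow>
        connected_component (ball z r - path_image g) p q \<or>
        connected_component (ball z r - path_image g) p w \<or>
        connected_component (ball z r - path_image g) q w"
    using arc_locally_two_sided[OF \<open>arc g\<close> _ _ r(1) ends] unfolding gz by auto
  \<comment> \<open>Inside the disc the whole curve is seen as \<open>g\<close> alone, since its
    other pieces belong to \<open>rest\<close>.\<close>
  have on_arc: "w \<in> path_image g \<longleftrightarrow> \<psi> w \<in> \<gamma> ` {0..1}" if "w \<in> ball z r" for w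
  proof
    assume "w \<in> path_image g"
    then show "\<psi> w \<in> \<gamma> ` {0..1}"
      unfolding path_image_def using \<psi>g k01 by auto
  next
    assume "\<psi> w \<in> \<gamma> ` {0..1}"
    then obtain t where t: "t \<in> {0..1}" "\<psi> w = \<gamma> t"
      by blast
    moreover have "\<psi> w \<notin> rest"
      using that r by blast
    ultimately have "t \<in> {a..b}"
      unfolding rest_def by force
    then obtain u where "u \<in> {0..1}" "\<psi> w = \<psi> (g u)"
      using k_onto t \<psi>g by metis
    then show "w \<in> path_image g"
      using \<psi>(3) unfolding path_image_def by (metis imageI injD)
  qed
  have same: "\<psi> q \<in> C"
    if C: "C \<in> connected_components_of Y" and p: "\<psi> p \<in> C"
      and pq: "connected_component (ball z r - path_image g) p q \<or> connected_component (ball z r - path_image g) q p"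
    for C p q
  proof -
    obtain T where T: "connected T" "T \<subseteq> ball z r - path_image g" "p \<in> T" "q \<in> T"
      using pq unfolding connected_component_def by blast
    have "\<psi> ` T \<subseteq> topspace X - (Z \<union> \<gamma> ` {0..1})"
    proof (rule image_subsetI)
      fix w assume "w \<in> T"
      then have w: "w \<in> ball z r" "w \<notin> path_image g"
        using T(2) by auto
      then have "\<psi> w \<in> topspace X" "\<psi> w \<notin> Z" "\<psi> w \<notin> \<gamma> ` {0..1}"
        using r(2) on_arc[of w] by (auto simp: rest_def)
      then show "\<psi> w \<in> topspace X - (Z \<union> \<gamma> ` {0..1})"
        by simp
    qed
    then have "connectedin Y (\<psi> ` T)"
      using connectedin_continuous_map_image[OF \<psi>(1), of T] T(1)
      by (simp add: Y_def connectedin_subtopology)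
    then have "\<psi> ` T \<subseteq> C"
      using connected_components_of_maximal[OF C] p T(3) by (metis disjnt_iff imageI)
    then show ?thesis
      using T(4) by blast
  qed
  define N where "N = \<psi> ` ball z \<delta>"
  have N: "openin X N" "\<gamma> c \<in> N"
    unfolding N_def using \<psi>(2,4) \<delta>(1) by (auto simp: open_map_def intro!: image_eqI[of _ _ z])
  have "\<exists>p \<in> ball z \<delta> - path_image g. \<psi> p \<in> C"
    if C: "C \<in> connected_components_of Y" "\<gamma> c \<in> X closure_of C" for C
  proof -
    obtain y where "y \<in> C" "y \<in> N"
      using C(2) N unfolding in_closure_of by blast
    moreover have "C \<subseteq> topspace X - (Z \<union> \<gamma> ` {0..1})"
      using connected_components_of_subset[OF C(1)] by (auto simp: Y_def)
    ultimately show ?thesis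
      unfolding N_def using on_arc \<delta>(2) by fastforce
  qed
  then obtain p\<^sub>1 p\<^sub>2 where p: "p\<^sub>1 \<in> ball z \<delta> - path_image g" "\<psi> p\<^sub>1 \<in> R\<^sub>1"
      "p\<^sub>2 \<in> ball z \<delta> - path_image g" "\<psi> p\<^sub>2 \<in> R\<^sub>2"
    using R unfolding Y_def by meson
  have RY: "R\<^sub>1 \<in> connected_components_of Y" "R\<^sub>2 \<in> connected_components_of Y"
    using R by (auto simp: Y_def)
  then have "R\<^sub>1 \<inter> R\<^sub>2 = {}"
    using R(3) connected_components_of_overlap by blast
  \<comment> \<open>This excludes one of the three alternatives in the three-point property, so a
    third point off the arc is joined to \<open>p\<^sub>1\<close> or to
    \<open>p\<^sub>2\<close>.\<close>
  then have sep: "\<not> connected_component (ball z r - path_image g) p\<^sub>1 p\<^sub>2"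
    using same[OF RY(1) p(2)] p(4) by blast
  have "N \<subseteq> R\<^sub>1 \<union> R\<^sub>2 \<union> \<gamma> ` {0<..<1}"
  proof
    fix y assume "y \<in> N"
    then obtain w where w: "w \<in> ball z \<delta>" "y = \<psi> w"
      unfolding N_def by blast
    then have wr: "w \<in> ball z r"
      using \<delta>(2) by auto
    show "y \<in> R\<^sub>1 \<union> R\<^sub>2 \<union> \<gamma> ` {0<..<1}"
    proof (cases "w \<in> path_image g")
      case True
      then obtain u where "u \<in> {0..1}" "w = g u"
        unfolding path_image_def by blast
      then have "y = \<gamma> (k u)" "k u \<in> {0<..<1}"
        using w \<psi>g k[of u] ab by auto
      then show ?thesis
        by blast
    next
      case False
      then show ?thesis
        using \<delta>(3)[OF p(1,3), of w] w sep same[OF RY(1) p(2), of w] same[OF RY(2) p(4), of w] by auto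
    qed
  qed
  then show ?thesis
    using that N by blast
qed

section \<open>Independence of even faces\<close>

lemma eset_subset_open_arc_Un_vertices:
  assumes "finite_simple_graph G" "embedded_in X G D" "e \<in> edges G"
  shows "eset D e \<subseteq> ecurve D e ` {0<..<1} \<union> vpoint D ` verts G"
proof
  fix y assume "y \<in> eset D e"
  then obtain t where t: "t \<in> {0..1}" "y = ecurve D e t"
    unfolding eset_def by blast
  have "vpoint D ` e \<subseteq> vpoint D ` verts G"
    using assms(1,3) unfolding finite_simple_graph_def by blast
  moreover have "{ecurve D e 0, ecurve D e 1} = vpoint D ` e"
    using assms(2,3) unfolding embedded_in_def by blast
  ultimately have "ecurve D e 0 \<in> vpoint D ` verts G" "ecurve D e 1 \<in> vpoint D ` verts G"
    by (metis insert_subset)+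
  moreover have "t = 0 \<or> t = 1 \<or> t \<in> {0<..<1}"
    using t(1) by auto
  ultimately show "y \<in> ecurve D e ` {0<..<1} \<union> vpoint D ` verts G"
    using t(2) by blast
qed

lemma closedin_eset:
  assumes "Hausdorff_space X" "embedded_in X G D" "e \<in> edges G"
  shows "closedin X (eset D e)"
proof -
  have "embedding_map (top_of_set {0..1}) X (ecurve D e)"
    using assms(2,3) unfolding embedded_in_def by blast
  then have "continuous_map (top_of_set {0..1}) X (ecurve D e)"
    unfolding embedding_map_def
    using homeomorphic_imp_continuous_map continuous_map_into_fulltopology by blast
  moreover have "compactin (top_of_set {0..1::real}) {0..1}"
    by (simp add: compactin_subtopology)
  ultimately show ?thesis
    unfolding eset_def using image_compactin compactin_imp_closedin[OF assms(1)] by blast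
qed

lemma finite_edges:
  assumes "finite_simple_graph G"
  shows "finite (edges G)"
proof -
  have "edges G \<subseteq> Pow (verts G)" "finite (Pow (verts G))"
    using assms unfolding finite_simple_graph_def by auto
  then show ?thesis
    by (rule finite_subset)
qed

text \<open>An edge on exactly one face of \<open>S\<close> survives in the sum of the edge sets,
  whence their independence. The vertices are left out of the open-and-closed argument because
  two-sidedness of edges says nothing there; being finitely many, they do not disconnect the surface
  when removed.\<close>

lemma even_faces_private_edge:
  assumes surf: "closed_surface X" and G: "finite_simple_graph G" and emb: "embedded_in X G D"
    and S: "S \<subset> faces X G D" "\<And>f. f \<in> S \<Longrightarrow> even_face X G D f" "finite S" "S \<noteq> {}"
  shows "\<exists>e. card {f \<in> S. e \<in> face_edges X G D f} = 1"
proof (rule ccontr)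
  assume no_private: "\<not> ?thesis"
  define P where "P = point_set G D"
  define V where "V = vpoint D ` verts G"
  \<comment> \<open>The open region behind a face. Distinct regions are disjoint, whereas closed
    faces may share edges and vertices.\<close>
  define reg where "reg f = f - P" for f
  have haus: "Hausdorff_space X"
    using surf by (simp add: closed_surface_def)
  have V: "finite V" "closedin X V"
  proof -
    show "finite V"
      using G by (simp add: V_def finite_simple_graph_def)
    then show "closedin X V"
      using emb closedin_Hausdorff_finite[OF haus] by (simp add: V_def embedded_in_def)
  qed
  have closed_esets: "closedin X (\<Union>e\<in>F. eset D e)" if "F \<subseteq> edges G" for F
    using that finite_edges[OF G] closedin_eset[OF haus emb]
    by (intro closedin_Union) (auto intro: finite_subset)
  have P: "closedin X P" "V \<subseteq> P" "\<And>e. e \<in> edges G \<Longrightarrow> eset D e \<subseteq> P"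
    unfolding P_def point_set_def using closed_esets[of "edges G"] V(2)
    by (auto simp: V_def intro: closedin_Un)
  have reg: "reg f \<in> regions X G D" "f = X closure_of reg f" if fF: "f \<in> faces X G D" for f
  proof -
    obtain C where "C \<in> regions X G D" "f = X closure_of C"
      using fF unfolding faces_def by blast
    moreover from this have "reg f = C"
      using closure_of_region_Diff unfolding reg_def P_def by blast
    ultimately show "reg f \<in> regions X G D" "f = X closure_of reg f"
      by simp_all
  qed
  have reg_inj: "f = f'" if "f \<in> faces X G D" "f' \<in> faces X G D" "reg f = reg f'" for f f'
    using reg(2) that by metis
  have reg_sub: "reg f \<noteq> {}" "reg f \<subseteq> topspace X - P" if "f \<in> faces X G D" for f
    using reg(1)[OF that] nonempty_connected_components_of connected_components_of_subset
    unfolding regions_def P_def by fastforce+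
  have reg_open: "openin X (reg f)" if "f \<in> faces X G D" for f
    using closed_surface_open_component[OF surf _ reg(1)[OF that, unfolded regions_def]] P(1)
    by (simp add: P_def openin_diff)
  \<comment> \<open>Here it matters that the boundary is a cycle of the graph: it is a union of full
    edge curves, so a point of the face on the drawing lies on an edge of that face.\<close>
  have bdry: "\<exists>e. e \<in> face_edges X G D f \<and> y \<in> eset D e" if fy: "f \<in> S" "y \<in> f" "y \<in> P" for f y
  proof -
    obtain vs where vs: "cycle_edges vs \<subseteq> edges G"
        "X frontier_of (reg f) = (\<Union>e\<in>cycle_edges vs. eset D e)"
      using S(2)[OF fy(1)] unfolding even_face_def cycle_in_def face_boundary_def reg_def P_def by blast
    have "f \<in> faces X G D"
      using S(1) that(1) by blast
    then have "y \<in> X closure_of reg f" "y \<notin> X interior_of reg f"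
      using reg(2) that interior_of_subset[of X "reg f"] unfolding reg_def by auto
    then have "y \<in> X frontier_of (reg f)"
      by (simp add: frontier_of_def)
    then show ?thesis
      using vs unfolding face_edges_def face_boundary_def reg_def P_def by blast
  qed
  have edge_in_face: "eset D e \<subseteq> f" if "f \<in> S" "e \<in> face_edges X G D f" for e f
  proof -
    have "f \<in> faces X G D"
      using S(1) that(1) by blast
    moreover have "eset D e \<subseteq> X frontier_of (reg f)"
      using that(2) by (simp add: face_edges_def face_boundary_def reg_def P_def)
    ultimately show ?thesis
      using reg(2) by (metis Diff_subset frontier_of_def order_trans)
  qed
  \<comment> \<open>By the negated claim, no edge lies on exactly one face of
    \<open>S\<close>.\<close>
  have second: "\<exists>f'\<in>S. f' \<noteq> f \<and> e \<in> face_edges X G D f'" if "f \<in> S" "e \<in> face_edges X G D f" for f e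
  proof (rule ccontr)
    assume "\<not> ?thesis"
    then have "{f' \<in> S. e \<in> face_edges X G D f'} = {f}"
      using that by blast
    then have "card {f' \<in> S. e \<in> face_edges X G D f'} = 1"
      by simp
    then show False
      using no_private by blast
  qed
  define W where "W = (topspace X - V) \<inter> \<Union> S"
  have "openin X W"
  proof (subst openin_subopen, intro ballI)
    fix y assume y: "y \<in> W"
    then obtain f where f: "f \<in> S" "y \<in> f" "y \<notin> V" "f \<in> faces X G D"
      using S(1) unfolding W_def by blast
    show "\<exists>N. openin X N \<and> y \<in> N \<and> N \<subseteq> W"
    proof (cases "y \<in> P")
      case False
      moreover have "reg f \<subseteq> W"
        using reg_sub[OF f(4)] P(2) f(1) unfolding W_def reg_def by blast
      ultimately show ?thesis
        using reg_open f unfolding reg_def by blast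
    next
      case True
      then obtain e where e: "e \<in> face_edges X G D f" "y \<in> eset D e"
        using bdry f by blast
      then have eG: "e \<in> edges G"
        by (simp add: face_edges_def)
      obtain c where c: "c \<in> {0<..<1}" "y = ecurve D e c"
        using eset_subset_open_arc_Un_vertices[OF G emb eG] e(2) f(3) unfolding V_def by blast
      obtain f' where f': "f' \<in> S" "f' \<noteq> f" "e \<in> face_edges X G D f'"
        using second f(1) e(1) by blast
      then have f'F: "f' \<in> faces X G D"
        using S(1) by blast
      \<comment> \<open>\<open>Z\<close> contains the ends of \<open>e\<close> but no interior point
        of it. Adding the curve of \<open>e\<close> gives back the drawing, so the components in the
        two-sidedness lemma are the regions of \<open>G\<close>.\<close>
      define Z where "Z = V \<union> (\<Union>e'\<in>edges G - {e}. eset D e')"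
      have ZP: "Z \<union> ecurve D e ` {0..1} = P"
        using eG unfolding Z_def P_def point_set_def V_def eset_def by blast
      have "y \<notin> eset D e'" if "e' \<in> edges G - {e}" for e'
      proof -
        have "ecurve D e ` {0<..<1} \<inter> ecurve D e' ` {0<..<1} = {}"
          using emb eG that unfolding embedded_in_def by blast
        then show ?thesis
          using eset_subset_open_arc_Un_vertices[OF G emb, of e'] that c f(3) unfolding V_def by blast
      qed
      then have yZ: "ecurve D e c \<notin> Z"
        using f(3) c(2) unfolding Z_def by blast
      have Zc: "closedin X Z"
        unfolding Z_def using V(2) closed_esets by (intro closedin_Un) auto
      have embe: "embedding_map (top_of_set {0..1}) X (ecurve D e)"
        using emb eG unfolding embedded_in_def by blast
      obtain N where N: "openin X N" "ecurve D e c \<in> N"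
          "N \<subseteq> reg f \<union> reg f' \<union> ecurve D e ` {0<..<1}"
      proof (rule embedded_arc_two_sided[OF surf embe Zc yZ, of "reg f" "reg f'"])
        show "reg f \<noteq> reg f'"
          using reg_inj f(4) f'(2) f'F by blast
        show "ecurve D e c \<in> X closure_of reg f"
          using reg(2)[OF f(4)] f(2) c(2) by simp
        show "ecurve D e c \<in> X closure_of reg f'"
          using reg(2)[OF f'F] edge_in_face[OF f'(1,3)] e(2) c(2) by auto
      qed (use c reg(1) f(4) f'F ZP in \<open>auto simp: regions_def P_def\<close>)
      have "ecurve D e ` {0<..<1} \<inter> V = {}"
        using emb eG unfolding embedded_in_def V_def by blast
      moreover have "ecurve D e ` {0<..<1} \<subseteq> eset D e"
        unfolding eset_def by (intro image_mono) auto
      ultimately have "ecurve D e ` {0<..<1} \<subseteq> W"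
        using edge_in_face[OF f(1) e(1)] f(1) closedin_subset[OF closedin_eset[OF haus emb eG]]
        unfolding W_def by blast
      moreover have "reg f \<subseteq> W" "reg f' \<subseteq> W"
        using reg_sub[OF f(4)] reg_sub[OF f'F] P(2) f(1) f'(1) unfolding W_def reg_def by blast+
      ultimately have "N \<subseteq> W"
        using N(3) by (meson Un_least order_trans)
      then show ?thesis
        using N(1,2) unfolding c(2) by blast
    qed
  qed
  moreover have "openin X (topspace X - \<Union> S)"
  proof -
    have "closedin X f" if "f \<in> S" for f
      using that S(1) reg(2) by (metis closedin_closure_of psubsetD)
    then have "closedin X (\<Union> S)"
      using S(3) by (intro closedin_Union) auto
    then show ?thesis
      by (simp add: openin_diff)
  qed
  moreover obtain f where "f \<in> S"
    using S(4) by blast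
  then have "W \<inter> (topspace X - V) \<noteq> {}"
    using reg_sub[of f] S(1) P(2) unfolding W_def reg_def by blast
  moreover have "topspace X - V \<subseteq> W \<union> (topspace X - \<Union> S)" "W \<inter> (topspace X - \<Union> S) \<inter> (topspace X - V) = {}"
    unfolding W_def by auto
  ultimately have all: "(topspace X - \<Union> S) \<inter> (topspace X - V) = {}"
    using connectedin_closed_surface_Diff_finite[OF surf V(1)] unfolding connectedin by blast
  \<comment> \<open>A face outside \<open>S\<close> gives the contradiction: a point of its region
    avoids the vertices, so it lies in some face of \<open>S\<close>, and overlapping regions
    coincide.\<close>
  obtain f0 where f0: "f0 \<in> faces X G D" "f0 \<notin> S"
    using S(1) by blast
  obtain y where y: "y \<in> reg f0"
    using reg_sub(1)[OF f0(1)] by blast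
  then have "y \<in> topspace X - P"
    using reg_sub(2)[OF f0(1)] by blast
  then obtain f1 where f1: "f1 \<in> S" "y \<in> reg f1"
    using all P(2) unfolding reg_def by blast
  have "reg f1 = reg f0"
    using connected_components_of_overlap[of "reg f1" _ "reg f0"] reg(1) f0(1) f1 y S(1)
    unfolding regions_def by blast
  then show False
    using reg_inj f0 f1(1) S(1) by blast
qed

section \<open>Labels of quotient graphs and the hypercube embedding\<close>

lemma component_of_eqI:
  assumes "{x, y} \<in> edges G"
  shows "component_of G x = component_of G y"
proof -
  have "(\<lambda>x y. {x, y} \<in> edges G) x y" "(\<lambda>x y. {x, y} \<in> edges G) y x"
    using assms by (auto simp: insert_commute)
  then show ?thesis
    unfolding component_of_def by (auto intro: converse_rtranclp_into_rtranclp)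
qed

text \<open>Edges outside \<open>S\<close> preserve \<open>p\<close>, so \<open>p\<close> is
  constant on the components that become vertices of the quotient; edges of \<open>S\<close> flip
  it, so its values form a proper 2-colouring.\<close>

lemma bipartite_quotient_graphI:
  fixes p :: "'v \<Rightarrow> bool"
  assumes p: "\<And>x y. {x, y} \<in> edges H \<Longrightarrow> p x \<noteq> p y \<longleftrightarrow> {x, y} \<in> S"
  shows "bipartite (quotient_graph H S)"
proof -
  define \<C> where "\<C> = component_sets (delete_edges H S)"
  have const: "p y = p x" if "y \<in> component_of (delete_edges H S) x" for x y
  proof -
    have "(\<lambda>x y. {x, y} \<in> edges H - S)\<^sup>*\<^sup>* x y"
      using that by (simp add: component_of_def delete_edges_def)
    then show ?thesis
    proof (induction rule: rtranclp_induct)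
      case (step y z)
      then show ?case
        using p[of y z] by auto
    qed simp
  qed
  then have same: "p x = p y" if "C \<in> \<C>" "x \<in> C" "y \<in> C" for C x y
    using that unfolding \<C>_def component_sets_def by (metis imageE)
  have nonempty: "C \<noteq> {}" if "C \<in> \<C>" for C
    using that unfolding \<C>_def component_sets_def component_of_def by (auto simp: delete_edges_def)
  define A B where "A = {C \<in> \<C>. \<exists>x\<in>C. \<not> p x}" and "B = {C \<in> \<C>. \<exists>x\<in>C. p x}"
  have "bipartition (quotient_graph H S) A B"
    unfolding bipartition_def
  proof (intro conjI ballI)
    show "A \<union> B = verts (quotient_graph H S)"
      using nonempty unfolding A_def B_def by (auto simp: quotient_graph_def \<C>_def)
    show "A \<inter> B = {}"
      using same unfolding A_def B_def by blast
    fix e assume "e \<in> edges (quotient_graph H S)"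
    then obtain C D x y where CD: "e = {C, D}" "C \<in> \<C>" "D \<in> \<C>" "x \<in> C" "y \<in> D" "{x, y} \<in> edges H \<inter> S"
      unfolding quotient_graph_def \<C>_def by auto
    then have "p x \<noteq> p y"
      using p by blast
    then have "C \<in> A \<and> D \<in> B \<or> D \<in> A \<and> C \<in> B"
      using CD unfolding A_def B_def by blast
    then show "\<exists>a\<in>A. \<exists>b\<in>B. e = {a, b}"
      using CD(1) by (metis insert_commute)
  qed
  then show ?thesis
    unfolding bipartite_def by blast
qed

text \<open>An edge of \<open>S\<close> becomes an edge of the quotient and so crosses the
  bipartition, while any other edge stays within one component. This works for every choice of
  bipartition.\<close>

lemma side_label_edge:
  assumes "bipartition (quotient_graph H S) A B" and xy: "{x, y} \<in> edges H" "x \<in> verts H" "y \<in> verts H"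
  shows "side_label H S A x \<noteq> side_label H S A y \<longleftrightarrow> {x, y} \<in> S"
proof (cases "{x, y} \<in> S")
  case True
  define C where "C v = component_of (delete_edges H S) v" for v
  have C: "v \<in> C v" "C v \<in> component_sets (delete_edges H S)" if "v \<in> verts H" for v
    using that by (auto simp: C_def component_of_def component_sets_def delete_edges_def)
  have "{C x, C y} \<in> edges (quotient_graph H S)"
    unfolding quotient_graph_def snd_conv
    using C[OF xy(2)] C[OF xy(3)] xy(1) True by (intro CollectI exI[of _ "C x"] exI[of _ "C y"]) auto
  then obtain a b where "a \<in> A" "b \<in> B" "{C x, C y} = {a, b}" "A \<inter> B = {}"
    using assms(1) unfolding bipartition_def by meson
  then have "(C x \<in> A) \<noteq> (C y \<in> A)"
    by (auto simp: doubleton_eq_iff)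
  then show ?thesis
    using True by (auto simp: side_label_def C_def)
next
  case False
  then have "{x, y} \<in> edges (delete_edges H S)"
    using xy by (simp add: delete_edges_def)
  then show ?thesis
    using False component_of_eqI by (metis side_label_def)
qed

section \<open>Sums of edge sets over the two-element field\<close>

definition parity_sum :: "('f \<Rightarrow> 'e set) \<Rightarrow> 'f set \<Rightarrow> 'e set" where
  "parity_sum E S = {e. odd (card {f \<in> S. e \<in> E f})}"

text \<open>Additivity modulo 2: members common to \<open>S\<close> and \<open>T\<close> are counted
  twice and cancel. Finiteness matters because \<open>card\<close> is 0 on infinite sets.\<close>

lemma parity_sum_sym_diff:
  assumes "finite S" "finite T"
  shows "parity_sum E (sym_diff S T) = sym_diff (parity_sum E S) (parity_sum E T)"
proof -
  have "odd (card {f \<in> sym_diff S T. e \<in> E f}) \<longleftrightarrow>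
      odd (card {f \<in> S. e \<in> E f}) \<noteq> odd (card {f \<in> T. e \<in> E f})" for e
  proof -
    define A B where "A = {f \<in> S. e \<in> E f}" and "B = {f \<in> T. e \<in> E f}"
    have fin: "finite A" "finite B"
      using assms by (auto simp: A_def B_def)
    have "card A = card (A - B) + card (A \<inter> B)" "card B = card (B - A) + card (A \<inter> B)"
      using fin by (metis Int_commute add.commute card_Diff_subset_Int card_mono finite_Int inf_le1
          le_add_diff_inverse)+
    moreover have "card (sym_diff A B) = card (A - B) + card (B - A)"
      using fin by (intro card_Un_disjoint) auto
    moreover have "{f \<in> sym_diff S T. e \<in> E f} = sym_diff A B"
      by (auto simp: A_def B_def)
    ultimately show ?thesis
      unfolding A_def[symmetric] B_def[symmetric] by auto
  qed
  then show ?thesis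
    unfolding parity_sum_def by auto
qed

lemma parity_sum_empty [simp]: "parity_sum E {} = {}"
  by (simp add: parity_sum_def)

lemma parity_sum_singleton [simp]: "parity_sum E {f} = E f"
proof -
  have "{g \<in> {f}. e \<in> E g} = (if e \<in> E f then {f} else {})" for e
    by auto
  then show ?thesis
    by (auto simp: parity_sum_def)
qed

section \<open>The hypercube embedding\<close>

theorem theorem3p5:
  fixes X :: "'s topology"
    and G :: "'v ugraph"
    and D :: "('v, 's) drawing"
    and \<F> :: "'s set set"
    and H :: "'v set set ugraph"
    and fs :: "'s set list"
  assumes "closed_surface X"
    and "finite_simple_graph G"
    and "embedded_in X G D"
    and "\<F> \<subseteq> {f \<in> faces X G D. even_face X G D f}"
    and "\<F> \<noteq> faces X G D"
    and "connected_component_graph H (resonance_graph X G D \<F>)"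
    and "distinct fs"
    and "set fs = corresponding_faces X G D \<F> H"
  shows "(\<forall>i<length fs. bipartite (quotient_graph H (corresponding_edges X G D H (fs ! i)))) \<and>
         (\<forall>A B. (\<forall>i<length fs.
                   bipartition (quotient_graph H (corresponding_edges X G D H (fs ! i))) (A i) (B i))
            \<longrightarrow> induced_subgraph_embedding
                  (\<lambda>M. map (\<lambda>i. side_label H (corresponding_edges X G D H (fs ! i)) (A i) M)
                           [0..<length fs])
                  H (hypercube (length fs)))"
proof -
  define E where "E = face_edges X G D"
  define R where "R = resonance_graph X G D \<F>"
  define CE where "CE = corresponding_edges X G D H"
  \<comment> \<open>The kernel of the parity sum is trivial. Since \<F> omits a face,
    \<open>S\<close> is a proper subset of the faces and has a private edge, which is counted once,
    an odd number.\<close>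
  have indep: "S = {}" if S: "finite S" "S \<subseteq> \<F>" "parity_sum E S = {}" for S
  proof (rule ccontr)
    assume "S \<noteq> {}"
    moreover have "S \<subset> faces X G D"
      using S(2) assms(4,5) by blast
    ultimately obtain e where "card {f \<in> S. e \<in> E f} = 1"
      using even_faces_private_edge[OF assms(1-3), of S] S(1,2) assms(4) unfolding E_def by blast
    then have "e \<in> parity_sum E S"
      by (simp add: parity_sum_def)
    then show False
      using S(3) by simp
  qed
  have parity_inj: "S = T" if "finite S" "finite T" "S \<subseteq> \<F>" "T \<subseteq> \<F>" "parity_sum E S = parity_sum E T" for S T
  proof -
    have "parity_sum E (sym_diff S T) = {}"
      using that by (simp add: parity_sum_sym_diff)
    then have "sym_diff S T = {}"
      using that by (intro indep) auto
    then show ?thesis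
      by blast
  qed
  \<comment> \<open>Hence each edge of \<open>H\<close> corresponds to exactly one face of
    \<F>.\<close>
  have E_inj: "f = g" if "f \<in> \<F>" "g \<in> \<F>" "E f = E g" for f g
    using parity_inj[of "{f}" "{g}"] that by simp
  obtain M0 where H: "H = (component_of R M0, {e \<in> edges R. e \<subseteq> component_of R M0})"
    using assms(6) unfolding connected_component_graph_def component_sets_def R_def by blast
  have vertsR: "M \<in> verts R \<longleftrightarrow> perfect_matching G M" for M
    by (simp add: R_def resonance_graph_def)
  have edgesR: "{M, M'} \<in> edges R \<longleftrightarrow> M \<in> verts R \<and> M' \<in> verts R \<and> (\<exists>f\<in>\<F>. sym_diff M M' = E f)" for M M'
    unfolding vertsR unfolding R_def resonance_graph_def E_def snd_conv
    by (auto simp: doubleton_eq_iff Un_commute)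
  have edgesH: "{M, M'} \<in> edges H \<longleftrightarrow> M \<in> verts H \<and> M' \<in> verts H \<and> (\<exists>f\<in>\<F>. sym_diff M M' = E f)" for M M'
    unfolding H fst_conv snd_conv using edgesR by (auto simp: component_of_def)
  have mem_CE: "{M, M'} \<in> CE f \<longleftrightarrow> {M, M'} \<in> edges H \<and> sym_diff M M' = E f" for M M' f
    unfolding CE_def corresponding_edges_def E_def
    by (auto simp: doubleton_eq_iff Un_commute insert_commute)
  have fs_\<F>: "set fs \<subseteq> \<F>"
    using assms(8) by (auto simp: corresponding_faces_def)
  have fs_I: "f \<in> set fs" if "f \<in> \<F>" "{M, M'} \<in> edges H" "sym_diff M M' = E f" for f M M'
    using that mem_CE[of M M' f] unfolding assms(8) corresponding_faces_def CE_def by blast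
  \<comment> \<open>A walk in the resonance graph from \<open>M0\<close> never leaves its component,
    so it is a walk in \<open>H\<close> and induction along edges of \<open>H\<close> is
    available.\<close>
  have reach: "(\<lambda>x y. {x, y} \<in> edges H)\<^sup>*\<^sup>* M0 M" if "M \<in> verts H" for M
  proof -
    have "(\<lambda>x y. {x, y} \<in> edges R)\<^sup>*\<^sup>* M0 M"
      using that by (simp add: H component_of_def)
    then show ?thesis
    proof (induction rule: rtranclp_induct)
      case (step M M')
      have "{M, M'} \<subseteq> component_of R M0"
        using step(1,2) edgesR by (auto simp: component_of_def intro: rtranclp.rtrancl_into_rtrancl)
      then have "{M, M'} \<in> edges H"
        using step(2) by (simp add: H)
      then show ?case
        using step(3) by (rule rtranclp.rtrancl_into_rtrancl[rotated])
    qed simp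
  qed
  \<comment> \<open>Walking along an edge that corresponds to \<open>f\<close> toggles
    \<open>f\<close> in the set collected so far.\<close>
  have ex_P: "\<exists>S. S \<subseteq> set fs \<and> sym_diff M0 M = parity_sum E S" if "M \<in> verts H" for M
    using reach[OF that]
  proof (induction rule: rtranclp_induct)
    case base
    show ?case
      by (rule exI[of _ "{}"]) simp
  next
    case (step M M')
    then obtain S where S: "S \<subseteq> set fs" "sym_diff M0 M = parity_sum E S"
      by blast
    obtain f where f: "f \<in> \<F>" "sym_diff M M' = E f"
      using step(2) edgesH by blast
    then have "f \<in> set fs"
      using fs_I step(2) by blast
    have "finite S"
      using S(1) by (rule finite_subset) simp
    then have "parity_sum E (sym_diff S {f}) = sym_diff (sym_diff M0 M) (sym_diff M M')"
      using S f by (simp add: parity_sum_sym_diff)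
    also have "\<dots> = sym_diff M0 M'"
      by blast
    finally show ?case
      using S(1) \<open>f \<in> set fs\<close> by (intro exI[of _ "sym_diff S {f}"]) auto
  qed
  then obtain P where P: "\<And>M. M \<in> verts H \<Longrightarrow> P M \<subseteq> set fs \<and> sym_diff M0 M = parity_sum E (P M)"
    by metis
  have fin: "finite (P M)" if "M \<in> verts H" for M
    using P[OF that] finite_subset by blast
  \<comment> \<open>The base matching cancels in the sum.\<close>
  have diff: "sym_diff M M' = parity_sum E (sym_diff (P M) (P M'))"
    if "M \<in> verts H" "M' \<in> verts H" for M M'
  proof -
    have "sym_diff M M' = sym_diff (sym_diff M0 M) (sym_diff M0 M')"
      by blast
    then show ?thesis
      using P fin that by (simp add: parity_sum_sym_diff)
  qed
  have diff_single: "sym_diff (P M) (P M') = {f} \<longleftrightarrow> sym_diff M M' = E f"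
    if "M \<in> verts H" "M' \<in> verts H" "f \<in> \<F>" for M M' f
  proof
    assume "sym_diff M M' = E f"
    then have "parity_sum E (sym_diff (P M) (P M')) = parity_sum E {f}"
      using diff that by simp
    then show "sym_diff (P M) (P M') = {f}"
      using P[OF that(1)] P[OF that(2)] fin that fs_\<F> by (intro parity_inj) auto
  qed (use diff that in simp)
  have P_edge: "(f \<in> P M) \<noteq> (f \<in> P M') \<longleftrightarrow> {M, M'} \<in> CE f"
    if MM: "{M, M'} \<in> edges H" and f: "f \<in> \<F>" for M M' f
  proof -
    obtain g where g: "g \<in> \<F>" "sym_diff M M' = E g"
      using MM edgesH by blast
    then have "sym_diff (P M) (P M') = {g}"
      using diff_single MM edgesH by blast
    then have "(f \<in> P M) \<noteq> (f \<in> P M') \<longleftrightarrow> f = g"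
      by blast
    also have "\<dots> \<longleftrightarrow> {M, M'} \<in> CE f"
      using mem_CE MM g f E_inj by metis
    finally show ?thesis .
  qed
  have "bipartite (quotient_graph H (CE (fs ! i)))" if "i < length fs" for i
  proof (rule bipartite_quotient_graphI[where p = "\<lambda>M. fs ! i \<in> P M"])
    show "(fs ! i \<in> P M) \<noteq> (fs ! i \<in> P M') \<longleftrightarrow> {M, M'} \<in> CE (fs ! i)"
      if "{M, M'} \<in> edges H" for M M'
      using P_edge[OF that] \<open>i < length fs\<close> fs_\<F> nth_mem by blast
  qed
  moreover have "induced_subgraph_embedding (\<lambda>M. map (\<lambda>i. side_label H (CE (fs ! i)) (A i) M) [0..<length fs])
                  H (hypercube (length fs))"
    if AB: "\<forall>i<length fs. bipartition (quotient_graph H (CE (fs ! i))) (A i) (B i)" for A B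
  proof -
    define k where "k = length fs"
    define L where "L i M = side_label H (CE (fs ! i)) (A i) M" for i M
    define lab where "lab M = map (\<lambda>i. L i M) [0..<k]" for M
    have L01: "L i M \<in> {0, 1}" for i M
      by (simp add: L_def side_label_def)
    \<comment> \<open>Label and membership toggle at the same edges of a walk from
      \<open>M0\<close>. Both take only two values, so only the parity of the number of toggles
      counts.\<close>
    have L_base: "L i M \<noteq> L i M0 \<longleftrightarrow> (fs ! i \<in> P M) \<noteq> (fs ! i \<in> P M0)" if i: "i < k" and M: "M \<in> verts H" for i M
      using reach[OF M]
    proof (induction rule: rtranclp_induct)
      case (step M M')
      have "L i M \<noteq> L i M' \<longleftrightarrow> {M, M'} \<in> CE (fs ! i)"
        unfolding L_def using AB i step(2) edgesH by (intro side_label_edge) (auto simp: k_def)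
      then have "L i M \<noteq> L i M' \<longleftrightarrow> (fs ! i \<in> P M) \<noteq> (fs ! i \<in> P M')"
        using P_edge[OF step(2)] i fs_\<F> nth_mem unfolding k_def by blast
      then show ?case
        using step(3) L01[of i M] L01[of i M'] L01[of i M0] by auto
    qed simp
    have L_diff: "L i M \<noteq> L i M' \<longleftrightarrow> fs ! i \<in> sym_diff (P M) (P M')"
      if "i < k" "M \<in> verts H" "M' \<in> verts H" for i M M'
      using L_base[OF that(1,2)] L_base[OF that(1,3)] L01[of i M] L01[of i M'] L01[of i M0] by auto
    \<comment> \<open>The coordinates in which two labels differ. As \<open>fs\<close> is distinct,
      indexing maps them bijectively onto the faces lying in exactly one of \<open>P M\<close> and
      \<open>P M'\<close>, so Hamming distance becomes a count of faces.\<close>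
    define I where "I M M' = {i. i < k \<and> lab M ! i \<noteq> lab M' ! i}" for M M'
    have I_img: "(!) fs ` I M M' = sym_diff (P M) (P M')" if M: "M \<in> verts H" "M' \<in> verts H" for M M'
    proof -
      have "I M M' = {i. i < k \<and> fs ! i \<in> sym_diff (P M) (P M')}"
        unfolding I_def using L_diff[OF _ M] by (intro Collect_cong) (simp add: lab_def cong: conj_cong)
      moreover have "sym_diff (P M) (P M') \<subseteq> set fs"
        using P M by blast
      ultimately show ?thesis
        by (auto simp: k_def in_set_conv_nth subset_iff)
    qed
    have I_inj: "inj_on ((!) fs) (I M M')" for M M'
      using assms(7) by (auto simp: inj_on_def I_def k_def nth_eq_iff_index_eq)
    have card_I: "card (I M M') = card (sym_diff (P M) (P M'))" if M: "M \<in> verts H" "M' \<in> verts H" for M M'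
      using card_image[OF I_inj[of M M']] I_img[OF M] by simp
    have lab_cube: "length (lab M) = k \<and> set (lab M) \<subseteq> {0, 1}" for M
      unfolding lab_def using L01[of _ M] by (simp add: image_subset_iff)
    have cube_edge: "{lab M, lab M'} \<in> edges (hypercube k) \<longleftrightarrow> card (I M M') = 1" for M M'
    proof -
      have "{i. i < k \<and> lab M' ! i \<noteq> lab M ! i} = {i. i < k \<and> lab M ! i \<noteq> lab M' ! i}"
        by auto
      then show ?thesis
        using lab_cube[of M] lab_cube[of M'] unfolding hypercube_def I_def
        by (auto simp: Let_def doubleton_eq_iff)
    qed
    have "induced_subgraph_embedding lab H (hypercube k)"
      unfolding induced_subgraph_embedding_def
    proof (intro conjI ballI)
      show "lab ` verts H \<subseteq> verts (hypercube k)"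
        using lab_cube by (auto simp: hypercube_def Let_def)
      show "inj_on lab (verts H)"
      proof (rule inj_onI)
        fix M M' assume M: "M \<in> verts H" "M' \<in> verts H" and "lab M = lab M'"
        then have "sym_diff (P M) (P M') = {}"
          using I_img[OF M] by (simp add: I_def)
        then have "sym_diff M M' = {}"
          using diff[OF M] by (metis parity_sum_empty)
        then show "M = M'"
          by blast
      qed
      fix M M' assume M: "M \<in> verts H" "M' \<in> verts H"
      \<comment> \<open>Both directions at once: a single differing face means that the matchings
        differ by its edge set, which is adjacency in the resonance graph and, within one component,
        in \<open>H\<close>.\<close>
      have "{M, M'} \<in> edges H \<longleftrightarrow> (\<exists>f\<in>\<F>. sym_diff (P M) (P M') = {f})"
        using edgesH M diff_single[OF M] by auto
      also have "\<dots> \<longleftrightarrow> card (sym_diff (P M) (P M')) = 1"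
      proof -
        have "(\<exists>f\<in>\<F>. T = {f}) \<longleftrightarrow> card T = 1" if "T \<subseteq> \<F>" for T
          using that by (auto simp: card_1_singleton_iff)
        moreover have "sym_diff (P M) (P M') \<subseteq> \<F>"
          using P[OF M(1)] P[OF M(2)] fs_\<F> by blast
        ultimately show ?thesis
          by blast
      qed
      finally show "{M, M'} \<in> edges H \<longleftrightarrow> {lab M, lab M'} \<in> edges (hypercube k)"
        using cube_edge card_I[OF M] by simp
    qed
    then show ?thesis
      unfolding lab_def L_def k_def .
  qed
  ultimately show ?thesis
    unfolding CE_def by blast
qed

end
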